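(* Let $k\ge1$, $r\ge2$, $m\ge1$ be arbitrary, $n=k+r$, and let a systematic scalar linear $[n,k]$ MDS code over a finite field $\mathbb F$ (the base code) be given. Put $$t=\left\lceil\frac kr+\frac{r-2}{2r}\right\rceil,\qquad t_r=k-(r-1)t .$$ Then the piggybacking of $2m$ instances of the base code described in the context (a code over the same field $\mathbb F$, with $2m$ substripes and $2mk$ message symbols, in which each of the first $k$ nodes stores its $2m$ message symbols uncoded) is an $[n,k]$ MDS code, and both of the following hold. (i) The systematic nodes can be repaired with an average amount of data read and downloaded, as a fraction of the total number $2mk$ of message symbols, equal to $$\gamma_1^{\mathrm{sys}}=\frac1{2k^2}\Bigl[(k-t_r)(k+t)+t_r(k+t_r+r-2)\Bigr].$$ (ii) The parity nodes can be repaired with an average amount of data read and downloaded, as a fraction of the total number $2mk$ of message symbols, equal to $$\gamma_1^{\mathrm{par}}=\frac1{2kr}\left[2k+(r-1)\left(\Bigl(1+\frac1m\Bigr)k+\Bigl(1-\frac1m\Bigr)(r-1)\right)\right].$$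
   Context: Base code: for a message $\mathbf a\in\mathbb F^k$, node $i\le k$ stores $a_i$ and node $k+j$ ($1\le j\le r$) stores $\mathbf p_j^T\mathbf a$ for fixed $\mathbf p_j=[p_{j,1}\cdots p_{j,k}]^T\in\mathbb F^k$; MDS means $\mathbf a$ can be recovered from any $k$ of the $n$ nodes. The first $k$ nodes are the systematic nodes, the remaining $r$ nodes the parity nodes. First piggybacking (two instances): partition $\{1,\ldots,k\}$ into consecutive blocks $S_1,\ldots,S_r$, with $S_1,\ldots,S_{r-1}$ of size $t$ and $S_r$ of size $t_r$. For $i=1,\ldots,r$ let $\mathbf q_{i+1}\in\mathbb F^k$ have $j$-th entry $p_{r,j}$ if $j\in S_i$ and $0$ otherwise, and let $\mathbf v_r=\mathbf p_r-\mathbf q_r$. For a message $(\mathbf a,\mathbf b)$, node $i\le k$ stores $(a_i,b_i)$; node $k+1$ stores $(\mathbf p_1^T\mathbf a,\ \mathbf p_1^T\mathbf b)$; node $k+i$ for $2\le i\le r-1$ stores $(\mathbf p_i^T\mathbf a,\ \mathbf p_i^T\mathbf b+\mathbf q_i^T\mathbf a)$; node $k+r$ stores $(\mathbf v_r^T\mathbf a-\mathbf p_r^T\mathbf b,\ \mathbf p_r^T\mathbf b+\mathbf q_r^T\mathbf a)$. Second piggybacking: take $m$ instances of this two-substripe code, placed side by side, giving $2m$ substripes. For every $i\in\{2,4,\ldots,2m-2\}$, add the sum of the $i$-th symbols of nodes $k+2,\ldots,k+r$ to the $(i+1)$-th symbol of node $k+1$; all other symbols are unchanged. The number of substripes is the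 number of symbols of $\mathbb F$ per node. The resulting code is $[n,k]$ MDS if all $2mk$ message symbols can be recovered from the contents of any $k$ nodes. Repair of a node by reading and downloading $\rho$ symbols: there is a set of $\rho$ symbols stored in the other nodes (depending only on the identity of the failed node) which are transferred unprocessed and which determine all symbols of the failed node. Averages are uniform over the $k$ systematic, respectively the $r$ parity, nodes.
   Formalization: The English allows arbitrary k and r, but the prescribed block sizes can be impossible (k=r=3 gives t=2, t_r=-1, so the code is undefined); the formal theorem assumes that the partition into blocks S_1,…,S_r of sizes t,…,t,t_r exists, i.e. t_r≥0. *)

theory Defs
  imports Complex_Main "HOL-Library.FuncSet"
begin

text \<open>
  Nodes, substripes and message coordinates are numbered from 1. An encoder maps a message \<open>x\<close> to
  the function sending a position \<open>(i, s)\<close> to the \<open>s\<close>-th symbol stored in node \<open>i\<close>.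
\<close>

type_synonym position = "nat \<times> nat"

definition recoverable_from ::
    "'m set \<Rightarrow> ('m \<Rightarrow> position \<Rightarrow> 'a) \<Rightarrow> position set \<Rightarrow> ('m \<Rightarrow> 'c) \<Rightarrow> bool" where
  "recoverable_from M enc D f \<longleftrightarrow> (\<exists>dec. \<forall>x\<in>M. dec (restrict (enc x) D) = f x)"

definition MDS_code :: "nat \<Rightarrow> nat \<Rightarrow> nat \<Rightarrow> 'm set \<Rightarrow> ('m \<Rightarrow> position \<Rightarrow> 'a) \<Rightarrow> bool" where
  "MDS_code n k L M enc \<longleftrightarrow>
     (\<forall>N. N \<subseteq> {1..n} \<and> card N = k \<longrightarrow> recoverable_from M enc (N \<times> {1..L}) (\<lambda>x. x))"

definition repairable_with ::
    "nat \<Rightarrow> nat \<Rightarrow> 'm set \<Rightarrow> ('m \<Rightarrow> position \<Rightarrow> 'a) \<Rightarrow> nat \<Rightarrow> nat \<Rightarrow> bool" where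
  "repairable_with n L M enc i \<rho> \<longleftrightarrow>
     (\<exists>D \<subseteq> ({1..n} - {i}) \<times> {1..L}. card D = \<rho> \<and>
        recoverable_from M enc D (\<lambda>x. restrict (enc x) ({i} \<times> {1..L})))"

text \<open>\<open>B\<close> is the number of message symbols and \<open>I\<close> the set of nodes averaged over.\<close>

definition average_repair ::
    "nat \<Rightarrow> nat \<Rightarrow> 'm set \<Rightarrow> ('m \<Rightarrow> position \<Rightarrow> 'a) \<Rightarrow> nat \<Rightarrow> nat set \<Rightarrow> real \<Rightarrow> bool" where
  "average_repair n L M enc B I \<gamma> \<longleftrightarrow>
     (\<exists>\<rho>. (\<forall>i\<in>I. repairable_with n L M enc i (\<rho> i)) \<and>
          (\<Sum>i\<in>I. real (\<rho> i) / real B) / real (card I) = \<gamma>)"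

definition dot :: "nat \<Rightarrow> (nat \<Rightarrow> 'a) \<Rightarrow> (nat \<Rightarrow> 'a) \<Rightarrow> 'a::comm_ring_1" where
  "dot k u w = (\<Sum>j=1..k. u j * w j)"

text \<open>\<open>P j i\<close> is the entry \<open>p\<close> with indices \<open>j, i\<close>, so \<open>P j\<close> is the \<open>j\<close>-th parity vector.\<close>

definition base_messages :: "nat \<Rightarrow> (nat \<Rightarrow> 'a) set" where
  "base_messages k = {1..k} \<rightarrow>\<^sub>E UNIV"

definition base_code ::
    "nat \<Rightarrow> (nat \<Rightarrow> nat \<Rightarrow> 'a) \<Rightarrow> (nat \<Rightarrow> 'a) \<Rightarrow> position \<Rightarrow> 'a::comm_ring_1" where
  "base_code k P a = (\<lambda>(i, _). if i \<le> k then a i else dot k (P (i - k)) a)"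

text \<open>The ordering condition forces the blocks to be disjoint and consecutive. A prescribed last
  size \<open>t\<^sub>r < 0\<close> (small \<open>k\<close> relative to \<open>r\<close>) admits no such blocks, hence no code.\<close>

definition consecutive_blocks :: "nat \<Rightarrow> nat \<Rightarrow> int \<Rightarrow> int \<Rightarrow> (nat \<Rightarrow> nat set) \<Rightarrow> bool" where
  "consecutive_blocks k r t t\<^sub>r S \<longleftrightarrow>
     (\<Union>i\<in>{1..r}. S i) = {1..k} \<and>
     (\<forall>i\<in>{1..r}. \<forall>j\<in>{1..r}. i < j \<longrightarrow> (\<forall>x\<in>S i. \<forall>y\<in>S j. x < y)) \<and>
     (\<forall>i\<in>{1..r-1}. int (card (S i)) = t) \<and>
     int (card (S r)) = t\<^sub>r"

text \<open>\<open>q_vec r P S i\<close> belongs to the block with index \<open>i - 1\<close>; it is meant for \<open>2 \<le> i \<le> r + 1\<close>.\<close>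

definition q_vec ::
    "nat \<Rightarrow> (nat \<Rightarrow> nat \<Rightarrow> 'a) \<Rightarrow> (nat \<Rightarrow> nat set) \<Rightarrow> nat \<Rightarrow> nat \<Rightarrow> 'a::comm_ring_1" where
  "q_vec r P S i = (\<lambda>j. if j \<in> S (i - 1) then P r j else 0)"

definition v_vec ::
    "nat \<Rightarrow> (nat \<Rightarrow> nat \<Rightarrow> 'a) \<Rightarrow> (nat \<Rightarrow> nat set) \<Rightarrow> nat \<Rightarrow> 'a::comm_ring_1" where
  "v_vec r P S = (\<lambda>j. P r j - q_vec r P S r j)"

definition piggyback1 ::
    "nat \<Rightarrow> nat \<Rightarrow> (nat \<Rightarrow> nat \<Rightarrow> 'a) \<Rightarrow> (nat \<Rightarrow> nat set) \<Rightarrow>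
     (nat \<Rightarrow> 'a) \<Rightarrow> (nat \<Rightarrow> 'a) \<Rightarrow> nat \<Rightarrow> 'a \<times> 'a::comm_ring_1" where
  "piggyback1 k r P S a b i =
     (if i \<le> k then (a i, b i)
      else if i = k + 1 then (dot k (P 1) a, dot k (P 1) b)
      else if i < k + r then
        (dot k (P (i - k)) a, dot k (P (i - k)) b + dot k (q_vec r P S (i - k)) a)
      else
        (dot k (v_vec r P S) a - dot k (P r) b, dot k (P r) b + dot k (q_vec r P S r) a))"

text \<open>\<open>x s j\<close> is the message symbol of node \<open>j\<close> in substripe \<open>s\<close>; instance \<open>l\<close> carries the pair
  \<open>(x (2 * l - 1), x (2 * l))\<close> and occupies the substripes \<open>2 * l - 1\<close> and \<open>2 * l\<close>.\<close>

definition messages :: "nat \<Rightarrow> nat \<Rightarrow> (nat \<Rightarrow> nat \<Rightarrow> 'a) set" where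
  "messages k m = {1..2*m} \<rightarrow>\<^sub>E ({1..k} \<rightarrow>\<^sub>E UNIV)"

definition side_by_side ::
    "nat \<Rightarrow> nat \<Rightarrow> (nat \<Rightarrow> nat \<Rightarrow> 'a) \<Rightarrow> (nat \<Rightarrow> nat set) \<Rightarrow>
     (nat \<Rightarrow> nat \<Rightarrow> 'a) \<Rightarrow> position \<Rightarrow> 'a::comm_ring_1" where
  "side_by_side k r P S x = (\<lambda>(i, s).
     if odd s then fst (piggyback1 k r P S (x s) (x (s + 1)) i)
     else snd (piggyback1 k r P S (x (s - 1)) (x s) i))"

definition piggyback2 ::
    "nat \<Rightarrow> nat \<Rightarrow> nat \<Rightarrow> (nat \<Rightarrow> nat \<Rightarrow> 'a) \<Rightarrow> (nat \<Rightarrow> nat set) \<Rightarrow>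
     (nat \<Rightarrow> nat \<Rightarrow> 'a) \<Rightarrow> position \<Rightarrow> 'a::comm_ring_1" where
  "piggyback2 k r m P S x = (\<lambda>(i, s).
     if i = k + 1 \<and> (\<exists>e\<in>{2..2*m-2}. even e \<and> s = e + 1)
     then side_by_side k r P S x (i, s) + (\<Sum>j=2..r. side_by_side k r P S x (k + j, s - 1))
     else side_by_side k r P S x (i, s))"

end

(* A set of symbols determines another symbol iff any two messages agreeing on the former agree on
   the latter; all recoverability claims are treated as such comparisons of two messages x and y.

   MDS: the substripes are decoded in increasing order, since every piggyback only involves earlier
   substripes; at node k + r the two symbols of an instance add up to the base symbol p_r a.

   Systematic node i: b comes from the other systematic nodes and node k + 1. If i lies in S_l with
   l < r, the second symbol of node k + l + 1 then yields the block sum of p_r a over S_l. If i lies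
   in S_r, the first symbol of node k + r yields the sum over all blocks except S_(r-1), from which
   the blocks S_1, ..., S_(r-2) are removed by the second symbols of nodes k + 2, ..., k + r - 1.

   Parity node k + j, j >= 2: read all odd substripes and the last one of the systematic nodes. The
   remaining even symbols of node k + j come from the piggybacks in node k + 1 and the corresponding
   symbols of the other parity nodes. *)

theory Submission imports Defs begin

section \<open>Recoverability as injectivity\<close>

text \<open>A decoder is an arbitrary function of the observed symbols, so it suffices that
  \<open>f\<close> is constant on messages that look alike on \<open>D\<close>.\<close>

lemma recoverable_from_iff:
  "recoverable_from M enc D f \<longleftrightarrow>
     (\<forall>x\<in>M. \<forall>y\<in>M. (\<forall>p\<in>D. enc x p = enc y p) \<longrightarrow> f x = f y)"
proof
  assume "recoverable_from M enc D f"
  then obtain dec where dec: "\<And>x. x \<in> M \<Longrightarrow> dec (restrict (enc x) D) = f x"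
    unfolding recoverable_from_def by blast
  show "\<forall>x\<in>M. \<forall>y\<in>M. (\<forall>p\<in>D. enc x p = enc y p) \<longrightarrow> f x = f y"
  proof (intro ballI impI)
    fix x y assume "x \<in> M" "y \<in> M" "\<forall>p\<in>D. enc x p = enc y p"
    moreover from this have "restrict (enc x) D = restrict (enc y) D"
      by (auto simp: restrict_def)
    ultimately show "f x = f y" using dec by metis
  qed
next
  assume inj: "\<forall>x\<in>M. \<forall>y\<in>M. (\<forall>p\<in>D. enc x p = enc y p) \<longrightarrow> f x = f y"
  \<comment> \<open>The decoder picks any message compatible with the observation \<open>g\<close>;
    by \<open>inj\<close> the value of \<open>f\<close> does not depend on the choice.\<close>
  define dec where "dec g = f (SOME y. y \<in> M \<and> restrict (enc y) D = g)" for g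
  have "dec (restrict (enc x) D) = f x" if "x \<in> M" for x
  proof -
    let ?y = "SOME y. y \<in> M \<and> restrict (enc y) D = restrict (enc x) D"
    have "?y \<in> M \<and> restrict (enc ?y) D = restrict (enc x) D"
      by (rule someI[of _ x]) (simp add: that)
    then have "?y \<in> M" and eq: "restrict (enc ?y) D = restrict (enc x) D" by blast+
    moreover have "enc ?y p = enc x p" if "p \<in> D" for p
      using fun_cong[OF eq, of p] that by simp
    ultimately have "f ?y = f x" using inj that by blast
    then show ?thesis by (simp add: dec_def)
  qed
  then show "recoverable_from M enc D f"
    unfolding recoverable_from_def by blast
qed

lemma repairable_withI:
  assumes "D \<subseteq> ({1..n} - {i}) \<times> {1..L}" and "card D = \<rho>"
    and "\<And>x y s. \<lbrakk>x \<in> M; y \<in> M; \<And>p. p \<in> D \<Longrightarrow> enc x p = enc y p; s \<in> {1..L}\<rbrakk>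
           \<Longrightarrow> enc x (i, s) = enc y (i, s)"
  shows "repairable_with n L M enc i \<rho>"
  unfolding repairable_with_def recoverable_from_iff
proof (intro exI[of _ D] conjI ballI impI)
  fix x y assume "x \<in> M" "y \<in> M" "\<forall>p\<in>D. enc x p = enc y p"
  then have "enc x (i, s) = enc y (i, s)" if "s \<in> {1..L}" for s
    using assms(3) that by blast
  then show "restrict (enc x) ({i} \<times> {1..L}) = restrict (enc y) ({i} \<times> {1..L})"
    by (auto simp: restrict_def fun_eq_iff)
qed (use assms in auto)

lemma average_repairI:
  assumes "\<And>i. i \<in> I \<Longrightarrow> repairable_with n L M enc i (\<rho> i)"
    and "(\<Sum>i\<in>I. real (\<rho> i)) / (real B * real (card I)) = \<gamma>"
  shows "average_repair n L M enc B I \<gamma>"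
  unfolding average_repair_def using assms
  by (intro exI[of _ \<rho>]) (simp flip: sum_divide_distrib)

lemma dot_cong: "(\<And>j. j \<in> {1..k} \<Longrightarrow> u j * w j = u' j * w' j) \<Longrightarrow> dot k u w = dot k u' w'"
  unfolding dot_def by (rule sum.cong) auto

section \<open>Odd and even substripes\<close>

text \<open>In each instance the odd substripe carries \<open>a\<close> and the even one
  \<open>b\<close>; repair treats the two kinds differently.\<close>

definition odds :: "nat \<Rightarrow> nat set" where "odds m = {s \<in> {1..2 * m}. odd s}"
definition evens :: "nat \<Rightarrow> nat set" where "evens m = {s \<in> {1..2 * m}. even s}"

lemma odds_altdef: "odds m = (\<lambda>l. 2 * l - 1) ` {1..m}"
  by (auto simp: odds_def elim!: oddE intro!: image_eqI[of _ _ "Suc _"])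

lemma evens_altdef: "evens m = (\<lambda>l. 2 * l) ` {1..m}"
  by (auto simp: evens_def elim!: evenE)

lemma finite_odds [simp]: "finite (odds m)" and finite_evens [simp]: "finite (evens m)"
  by (simp_all add: odds_def evens_def)

lemma card_odds [simp]: "card (odds m) = m"
  unfolding odds_altdef by (subst card_image) (auto simp: inj_on_def)

lemma card_evens [simp]: "card (evens m) = m"
  unfolding evens_altdef by (subst card_image) (auto simp: inj_on_def)

lemma Suc_odd_le: "\<lbrakk>odd s; s \<in> {1..2 * m}\<rbrakk> \<Longrightarrow> s + 1 \<in> {1..2 * m}" for s :: nat
  by simp presburger

text \<open>Sets of this shape are read when a systematic node fails: \<open>card A + card B\<close>
  symbols for each of the \<open>m\<close> instances.\<close>

lemma card_evens_odds:
  assumes "finite A" "finite B"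
  shows "card (A \<times> evens m \<union> B \<times> odds m) = m * (card A + card B)"
proof -
  have "A \<times> evens m \<inter> B \<times> odds m = {}"
    by (auto simp: odds_def evens_def)
  then show ?thesis
    using assms by (simp add: card_Un_disjoint card_cartesian_product algebra_simps)
qed

section \<open>The piggybacked code\<close>

text \<open>The blocks enter as a disjoint cover of \<open>{1..k}\<close> and costs are counted
  through \<open>card (S l)\<close>; the sizes \<open>t\<close> and \<open>t\<^sub>r\<close> come in
  with the averages.\<close>

locale piggybacking =
  fixes k r m :: nat and P :: "nat \<Rightarrow> nat \<Rightarrow> 'a :: field" and S :: "nat \<Rightarrow> nat set"
  assumes k_pos: "k \<ge> 1" and r_ge: "r \<ge> 2" and m_pos: "m \<ge> 1"
    and base_MDS: "MDS_code (k + r) k 1 (base_messages k) (base_code k P)"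
    and blocks_union: "(\<Union>l\<in>{1..r}. S l) = {1..k}"
    and blocks_disjoint: "\<lbrakk>l \<in> {1..r}; l' \<in> {1..r}; l \<noteq> l'\<rbrakk> \<Longrightarrow> S l \<inter> S l' = {}"
begin

abbreviation "enc \<equiv> piggyback2 k r m P S"
abbreviation "sbs \<equiv> side_by_side k r P S"

lemma block_subset: "l \<in> {1..r} \<Longrightarrow> S l \<subseteq> {1..k}"
  using blocks_union by blast

lemma finite_block: "l \<in> {1..r} \<Longrightarrow> finite (S l)"
  using block_subset finite_subset by blast

section \<open>Consequences of the MDS property of the base code\<close>

lemma base_unique:
  assumes "a \<in> base_messages k" "a' \<in> base_messages k" "N \<subseteq> {1..k + r}" "card N = k"
    and "\<And>i. i \<in> N \<Longrightarrow> base_code k P a (i, 1) = base_code k P a' (i, 1)"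
  shows "a = a'"
proof -
  have "recoverable_from (base_messages k) (base_code k P) (N \<times> {1..1}) (\<lambda>x. x)"
    using base_MDS assms(3,4) unfolding MDS_code_def by blast
  then show ?thesis
    using assms(1,2,5) unfolding recoverable_from_iff by auto
qed

text \<open>The systematic nodes other than \<open>l\<close> together with node \<open>k + j\<close>
  are exactly \<open>k\<close> nodes.\<close>

lemma base_unique_one_parity:
  assumes "a \<in> base_messages k" "a' \<in> base_messages k" "l \<in> {1..k}" "j \<in> {1..r}"
    and "\<And>i. i \<in> {1..k} - {l} \<Longrightarrow> a i = a' i"
    and "dot k (P j) a = dot k (P j) a'"
  shows "a = a'"
proof (rule base_unique[of _ _ "insert (k + j) ({1..k} - {l})"])
  show "card (insert (k + j) ({1..k} - {l})) = k"
    using assms(3,4) by (subst card_insert_disjoint) auto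
  show "base_code k P a (i, 1) = base_code k P a' (i, 1)"
    if "i \<in> insert (k + j) ({1..k} - {l})" for i
    using that assms(4-6) by (auto simp: base_code_def)
qed (use assms in auto)

text \<open>Otherwise the \<open>l\<close>-th unit vector and the zero message would agree on node
  \<open>k + j\<close> and on all systematic nodes but \<open>l\<close>, against the MDS
  property.\<close>

lemma parity_entry_nonzero:
  assumes "l \<in> {1..k}" "j \<in> {1..r}"
  shows "P j l \<noteq> 0"
proof
  assume zero: "P j l = 0"
  define a a' :: "nat \<Rightarrow> 'a" where "a = restrict (\<lambda>i. if i = l then 1 else 0) {1..k}"
    and "a' = restrict (\<lambda>_. 0) {1..k}"
  have "a = a'"
  proof (rule base_unique_one_parity[OF _ _ assms])
    show "dot k (P j) a = dot k (P j) a'"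
      by (rule dot_cong) (use zero in \<open>auto simp: a_def a'_def\<close>)
  qed (auto simp: a_def a'_def base_messages_def)
  then have "a l = a' l" by simp
  then show False using assms by (simp add: a_def a'_def)
qed

text \<open>Subtracting the known terms leaves \<open>P r i * a i\<close>, whose coefficient is
  nonzero.\<close>

lemma block_sum_determines:
  assumes "T \<subseteq> {1..k}" "i \<in> T" "(\<Sum>j\<in>T. P r j * a j) = (\<Sum>j\<in>T. P r j * a' j)"
    and "\<And>j. j \<in> T - {i} \<Longrightarrow> a j = a' j"
  shows "a i = a' i"
proof -
  have "finite T" using assms(1) finite_subset by blast
  then have "(\<Sum>j\<in>T. P r j * c j) = P r i * c i + (\<Sum>j\<in>T - {i}. P r j * c j)" for c
    using assms(2) by (rule sum.remove)
  moreover have "(\<Sum>j\<in>T - {i}. P r j * a j) = (\<Sum>j\<in>T - {i}. P r j * a' j)"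
    using assms(4) by (intro sum.cong) auto
  ultimately have "P r i * a i = P r i * a' i" using assms(3) by simp
  then show ?thesis
    using parity_entry_nonzero[of i r] assms(1,2) r_ge by auto
qed

section \<open>Splitting the vector \<open>P r\<close> along the blocks\<close>

lemma dot_q_vec:
  assumes "j - 1 \<in> {1..r}"
  shows "dot k (q_vec r P S j) a = (\<Sum>i\<in>S (j - 1). P r i * a i)"
proof -
  have "dot k (q_vec r P S j) a = (\<Sum>i\<in>{1..k}. if i \<in> S (j - 1) then P r i * a i else 0)"
    unfolding dot_def q_vec_def by (rule sum.cong) auto
  also have "\<dots> = (\<Sum>i\<in>{1..k} \<inter> S (j - 1). P r i * a i)"
    by (simp add: sum.inter_restrict)
  also have "{1..k} \<inter> S (j - 1) = S (j - 1)"
    using block_subset[OF assms] by blast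
  finally show ?thesis .
qed

lemma dot_v_vec: "dot k (v_vec r P S) a = dot k (P r) a - dot k (q_vec r P S r) a"
  unfolding dot_def v_vec_def by (simp add: left_diff_distrib sum_subtractf)

lemma dot_parity_r: "dot k (P r) a = (\<Sum>l\<in>{1..r}. dot k (q_vec r P S (l + 1)) a)"
proof -
  have "dot k (P r) a = (\<Sum>i\<in>(\<Union>l\<in>{1..r}. S l). P r i * a i)"
    unfolding dot_def blocks_union ..
  also have "\<dots> = (\<Sum>l\<in>{1..r}. \<Sum>i\<in>S l. P r i * a i)"
    by (rule sum.UNION_disjoint) (use finite_block blocks_disjoint in auto)
  also have "\<dots> = (\<Sum>l\<in>{1..r}. dot k (q_vec r P S (l + 1)) a)"
    by (intro sum.cong) (auto simp: dot_q_vec)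
  finally show ?thesis .
qed

text \<open>Dropping index \<open>r\<close> from the block decomposition leaves the vector on
  \<open>S r\<close>, which no even symbol carries, and the piggybacks of nodes \<open>k + 2\<close>
  to \<open>k + r - 1\<close>.\<close>

lemma dot_v_vec_blocks:
  "dot k (v_vec r P S) a =
     dot k (q_vec r P S (r + 1)) a + (\<Sum>j\<in>{2..r - 1}. dot k (q_vec r P S j) a)"
proof -
  let ?q = "\<lambda>j. dot k (q_vec r P S j) a"
  have "dot k (P r) a = (\<Sum>j\<in>{2..r + 1}. ?q j)"
    unfolding dot_parity_r by (rule sum.reindex_bij_witness[of _ "\<lambda>j. j - 1" "\<lambda>l. l + 1"]) auto
  also have "{2..r + 1} = insert (r + 1) (insert r {2..r - 1})"
    using r_ge by auto
  also have "(\<Sum>j\<in>\<dots>. ?q j) = ?q (r + 1) + (?q r + (\<Sum>j\<in>{2..r - 1}. ?q j))"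
    using r_ge by (subst sum.insert; simp)+
  finally show ?thesis unfolding dot_v_vec by simp
qed

subsection \<open>The stored symbols\<close>

lemma node_cases: "i \<in> {1..k + r} \<Longrightarrow> i \<in> {1..k} \<or> i = k + 1 \<or> (\<exists>j\<in>{2..r}. i = k + j)"
  by (cases "i \<le> k + 1") (auto intro!: bexI[of _ "i - k"])

lemma enc_systematic: "i \<le> k \<Longrightarrow> enc x (i, s) = x s i"
  by (simp add: piggyback2_def side_by_side_def piggyback1_def)

lemma enc_other_parity: "j \<ge> 2 \<Longrightarrow> enc x (k + j, s) = sbs x (k + j, s)"
  by (simp add: piggyback2_def)

lemma sbs_parity_1: "sbs x (k + 1, s) = dot k (P 1) (x s)"
  by (simp add: side_by_side_def piggyback1_def)

text \<open>The case \<open>j = r\<close> is included, since only the first symbol of node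
  \<open>k + r\<close> deviates from the common pattern.\<close>

lemma sbs_even:
  "\<lbrakk>2 \<le> j; j \<le> r; even s\<rbrakk> \<Longrightarrow>
     sbs x (k + j, s) = dot k (P j) (x s) + dot k (q_vec r P S j) (x (s - 1))"
  by (auto simp: side_by_side_def piggyback1_def)

lemma sbs_odd: "\<lbrakk>2 \<le> j; j < r; odd s\<rbrakk> \<Longrightarrow> sbs x (k + j, s) = dot k (P j) (x s)"
  by (auto simp: side_by_side_def piggyback1_def)

lemma sbs_odd_last:
  "odd s \<Longrightarrow> sbs x (k + r, s) = dot k (v_vec r P S) (x s) - dot k (P r) (x (s + 1))"
  using r_ge by (auto simp: side_by_side_def piggyback1_def)

text \<open>Used in both directions: to decode \<open>P r\<close> in an odd substripe from two
  stored symbols, and to rebuild the odd symbol of node \<open>k + r\<close> from its even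
  one.\<close>

lemma sbs_odd_last_cancel: "odd s \<Longrightarrow> sbs x (k + r, s) = dot k (P r) (x s) - sbs x (k + r, s + 1)"
  using r_ge by (simp add: sbs_odd_last sbs_even dot_v_vec)

text \<open>Parity sums are added only in odd substripes preceded by an even one, that is, from
  substripe 3 on.\<close>

lemma enc_parity_1_unpiggybacked:
  "even s \<or> s = 1 \<Longrightarrow> enc x (k + 1, s) = dot k (P 1) (x s)"
  by (auto simp: piggyback2_def sbs_parity_1[simplified])

lemma enc_parity_1_piggybacked:
  assumes "even s" "1 \<le> s" "s < 2 * m"
  shows "enc x (k + 1, s + 1) = dot k (P 1) (x (s + 1)) + (\<Sum>j=2..r. sbs x (k + j, s))"
proof -
  \<comment> \<open>Evenness sharpens the bounds on \<open>s\<close> to \<open>2 \<le> s\<close> and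
    \<open>s \<le> 2 * m - 2\<close>.\<close>
  have "\<exists>e\<in>{2..2*m-2}. even e \<and> s + 1 = e + 1"
    using assms by (intro bexI[of _ s]) (auto elim!: evenE)
  then show ?thesis
    unfolding piggyback2_def using sbs_parity_1[of x "s + 1"] by simp
qed

lemma message_component: "\<lbrakk>x \<in> messages k m; s \<in> {1..2 * m}\<rbrakk> \<Longrightarrow> x s \<in> base_messages k"
  by (auto simp: messages_def base_messages_def PiE_iff)

lemma message_component_eqI:
  assumes "x \<in> messages k m" "y \<in> messages k m" "s \<in> {1..2 * m}"
    and "\<And>i. i \<in> {1..k} \<Longrightarrow> x s i = y s i"
  shows "x s = y s"
proof (rule PiE_ext)
  show "x s \<in> {1..k} \<rightarrow>\<^sub>E UNIV" "y s \<in> {1..k} \<rightarrow>\<^sub>E UNIV"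
    using assms(1-3) message_component by (auto simp: base_messages_def)
qed (use assms(4) in auto)

subsection \<open>Decoding\<close>

lemma decode_substripe:
  assumes x: "x \<in> messages k m" and y: "y \<in> messages k m"
    and N: "N \<subseteq> {1..k + r}" "card N = k"
    and eq: "\<And>i s. i \<in> N \<Longrightarrow> s \<in> {1..2 * m} \<Longrightarrow> enc x (i, s) = enc y (i, s)"
  shows "s \<in> {1..2 * m} \<Longrightarrow> x s = y s"
proof (induction s rule: less_induct)
  case (less s)
  have earlier: "x s' = y s'" if "s' < s" "s' \<ge> 1" for s'
    using less.IH[of s'] that less.prems by auto
  show ?case
  proof (rule base_unique[OF _ _ N])
    show "x s \<in> base_messages k" "y s \<in> base_messages k"
      using x y less.prems message_component by auto
    fix i assume i: "i \<in> N"
    then have "i \<in> {1..k + r}" using N by blast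
    then consider "i \<in> {1..k}" | "i = k + 1" | j where "j \<in> {2..r}" "i = k + j"
      using node_cases by blast
    then show "base_code k P (x s) (i, 1) = base_code k P (y s) (i, 1)"
    proof cases
      case 1
      then show ?thesis
        using eq[OF i less.prems] by (simp add: base_code_def enc_systematic)
    next
      case 2
      have "dot k (P 1) (x s) = dot k (P 1) (y s)"
      proof (cases "even s \<or> s = 1")
        case True
        then show ?thesis
          using eq[OF i less.prems] 2 enc_parity_1_unpiggybacked by simp
      next
        case False
        \<comment> \<open>Here \<open>s\<close> is odd and at least 3; the added parity sum depends
          only on substripes \<open>e\<close> and \<open>e - 1\<close>, which are already
          decoded.\<close>
        define e where "e = s - 1"
        have e: "even e" "2 \<le> e" "e < 2 * m" "s = e + 1"
          using False less.prems by (auto simp: e_def elim!: oddE)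
        have "sbs x (k + j, e) = sbs y (k + j, e)" if "j \<in> {2..r}" for j
          using that e earlier[of e] earlier[of "e - 1"] by (simp add: sbs_even)
        then show ?thesis
          using eq[OF i less.prems] 2 e by (simp add: enc_parity_1_piggybacked[simplified])
      qed
      then show ?thesis using 2 by (simp add: base_code_def)
    next
      case (3 j)
      have sbs_eq: "sbs x (i, s') = sbs y (i, s')" if "s' \<in> {1..2 * m}" for s'
        using eq[OF i that] 3 by (simp add: enc_other_parity)
      have "dot k (P j) (x s) = dot k (P j) (y s)"
      proof (cases "even s")
        case True
        then have "x (s - 1) = y (s - 1)"
          using less.prems by (intro earlier) (auto elim!: evenE)
        then show ?thesis
          using sbs_eq[OF less.prems] 3 True by (simp add: sbs_even)
      next
        case False
        \<comment> \<open>For \<open>j = r\<close> the stored symbol of substripe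
          \<open>s + 1\<close> is used, not its message, so the order of the induction is
          respected.\<close>
        then have "s + 1 \<in> {1..2 * m}" using less.prems by (intro Suc_odd_le)
        then show ?thesis
          using sbs_eq[of "s + 1"] sbs_eq[OF less.prems] 3 False
          by (cases "j = r") (simp_all add: sbs_odd_last_cancel sbs_odd)
      qed
      then show ?thesis using 3 by (simp add: base_code_def)
    qed
  qed
qed

lemma piggyback2_MDS: "MDS_code (k + r) k (2 * m) (messages k m) enc"
  unfolding MDS_code_def recoverable_from_iff
proof (intro allI impI ballI)
  fix N x y
  assume N: "N \<subseteq> {1..k + r} \<and> card N = k" and xy: "x \<in> messages k m" "y \<in> messages k m"
    and eq: "\<forall>p\<in>N \<times> {1..2 * m}. enc x p = enc y p"
  show "x = y"
  proof (rule PiE_ext)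
    show "x \<in> {1..2 * m} \<rightarrow>\<^sub>E ({1..k} \<rightarrow>\<^sub>E UNIV)" "y \<in> {1..2 * m} \<rightarrow>\<^sub>E ({1..k} \<rightarrow>\<^sub>E UNIV)"
      using xy by (simp_all add: messages_def)
    show "x s = y s" if "s \<in> {1..2 * m}" for s
      using that N eq by (intro decode_substripe[OF xy, of N]) auto
  qed
qed

subsection \<open>Repair of the systematic nodes\<close>

text \<open>In even substripes node \<open>k + 1\<close> and the systematic nodes hold plain base
  code symbols.\<close>

lemma decode_even_substripe:
  assumes "x \<in> messages k m" "y \<in> messages k m" "i \<in> {1..k}" "s \<in> evens m"
    and "\<And>i'. i' \<in> insert (k + 1) ({1..k} - {i}) \<Longrightarrow> enc x (i', s) = enc y (i', s)"
  shows "x s = y s"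
proof (rule base_unique_one_parity[OF _ _ assms(3)])
  have s: "even s" "s \<in> {1..2 * m}" using assms(4) by (auto simp: evens_def)
  then show "x s \<in> base_messages k" "y s \<in> base_messages k"
    using assms(1,2) message_component by auto
  show "1 \<in> {1..r}" using r_ge by simp
  show "dot k (P 1) (x s) = dot k (P 1) (y s)"
    using assms(5)[of "k + 1"] s by (simp add: enc_parity_1_unpiggybacked[simplified])
  show "x s i' = y s i'" if "i' \<in> {1..k} - {i}" for i'
    using assms(5)[of i'] that by (simp add: enc_systematic)
qed

text \<open>Reduces repair to a single instance: the nodes in \<open>A\<close> are read in even and
  those in \<open>B\<close> in odd substripes, and once the even half is decoded only one odd symbol
  is missing.\<close>

lemma systematic_repairI:
  assumes i: "i \<in> {1..k}"
    and A: "insert (k + 1) ({1..k} - {i}) \<subseteq> A" "A \<subseteq> {1..k + r} - {i}"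
    and B: "B \<subseteq> {1..k + r} - {i}"
    and odd_symbol: "\<And>x y s. \<lbrakk>odd s; s \<in> {1..2 * m}; x (s + 1) = y (s + 1);
        \<And>i'. i' \<in> A \<Longrightarrow> enc x (i', s + 1) = enc y (i', s + 1);
        \<And>i'. i' \<in> B \<Longrightarrow> enc x (i', s) = enc y (i', s)\<rbrakk> \<Longrightarrow> x s i = y s i"
  shows "repairable_with (k + r) (2 * m) (messages k m) enc i (m * (card A + card B))"
proof (rule repairable_withI[where D = "A \<times> evens m \<union> B \<times> odds m"])
  show "A \<times> evens m \<union> B \<times> odds m \<subseteq> ({1..k + r} - {i}) \<times> {1..2 * m}"
    using A B by (auto simp: evens_def odds_def)
  have "finite A" "finite B" using A B by (auto intro: finite_subset)
  then show "card (A \<times> evens m \<union> B \<times> odds m) = m * (card A + card B)"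
    by (rule card_evens_odds)
  fix x y s
  assume xy: "x \<in> messages k m" "y \<in> messages k m" and s: "s \<in> {1..2 * m}"
    and eq: "\<And>p. p \<in> A \<times> evens m \<union> B \<times> odds m \<Longrightarrow> enc x p = enc y p"
  have even: "x e = y e" if "e \<in> evens m" for e
    using that A by (intro decode_even_substripe[OF xy i that] eq) auto
  have "x s i = y s i"
  proof (cases "even s")
    case True
    then show ?thesis using even[of s] s by (simp add: evens_def)
  next
    case False
    then have "s + 1 \<in> evens m" "s \<in> odds m"
      using s Suc_odd_le[of s m] by (simp_all add: evens_def odds_def)
    then show ?thesis
      using odd_symbol[of s x y, OF False s] even eq by blast
  qed
  then show "enc x (i, s) = enc y (i, s)" using i by (simp add: enc_systematic)
qed

lemma repair_systematic:
  assumes l: "l \<in> {1..r - 1}" and i: "i \<in> S l"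
  shows "repairable_with (k + r) (2 * m) (messages k m) enc i (m * (k + card (S l)))"
proof -
  have lr: "l \<in> {1..r}" using l by auto
  have ik: "i \<in> {1..k}" using block_subset[OF lr] i by blast
  \<comment> \<open>Two parity nodes and \<open>k - 1\<close> systematic ones, then the rest of the
    block: \<open>k + card (S l)\<close> symbols per instance.\<close>
  let ?A = "{k + l + 1, k + 1} \<union> ({1..k} - {i})" and ?B = "S l - {i}"
  have "repairable_with (k + r) (2 * m) (messages k m) enc i (m * (card ?A + card ?B))"
  proof (rule systematic_repairI[OF ik])
    fix x y s
    assume s: "odd s" "s \<in> {1..2 * m}" and even: "x (s + 1) = y (s + 1)"
      and A: "\<And>i'. i' \<in> ?A \<Longrightarrow> enc x (i', s + 1) = enc y (i', s + 1)"
      and B: "\<And>i'. i' \<in> ?B \<Longrightarrow> enc x (i', s) = enc y (i', s)"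
    have l1: "2 \<le> l + 1" "l + 1 \<le> r" using l by auto
    have "sbs x (k + (l + 1), s + 1) = sbs y (k + (l + 1), s + 1)"
      using A[of "k + l + 1"] enc_other_parity[OF l1(1)] by (simp add: add.assoc)
    \<comment> \<open>The base part of this symbol depends only on the decoded even half and
      cancels.\<close>
    then have "dot k (q_vec r P S (l + 1)) (x s) = dot k (q_vec r P S (l + 1)) (y s)"
      using sbs_even[OF l1, of "s + 1"] s even by simp
    then have "(\<Sum>j\<in>S l. P r j * x s j) = (\<Sum>j\<in>S l. P r j * y s j)"
      using lr by (simp add: dot_q_vec)
    then show "x s i = y s i"
    proof (rule block_sum_determines[OF block_subset[OF lr] i])
      show "x s j = y s j" if "j \<in> S l - {i}" for j
      proof -
        have "j \<le> k" using that block_subset[OF lr] by auto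
        then show ?thesis using B[of j] that by (simp add: enc_systematic)
      qed
    qed
  qed (use l ik block_subset[OF lr] in auto)
  moreover have "card ?A = k + 1"
    using ik l by (subst card_Un_disjoint) auto
  moreover have "card ?B = card (S l) - 1" "card (S l) \<ge> 1"
    using finite_block[OF lr] i by (auto simp: Suc_le_eq card_gt_0_iff)
  ultimately show ?thesis by simp
qed

lemma repair_systematic_last_block:
  assumes i: "i \<in> S r"
  shows "repairable_with (k + r) (2 * m) (messages k m) enc i (m * (k + card (S r) + r - 2))"
proof -
  have r: "r \<in> {1..r}" using r_ge by auto
  have ik: "i \<in> {1..k}" using block_subset[OF r] i by blast
  \<comment> \<open>In odd substripes node \<open>k + r\<close> takes the place of \<open>i\<close>,
    so \<open>card (S r)\<close> symbols are read there; the \<open>r - 1\<close> other parity nodes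
    serve in even substripes.\<close>
  let ?A = "{k + 1..k + r - 1} \<union> ({1..k} - {i})" and ?B = "insert (k + r) (S r - {i})"
  have repairable: "repairable_with (k + r) (2 * m) (messages k m) enc i (m * (card ?A + card ?B))"
  proof (rule systematic_repairI[OF ik])
    fix x y s
    assume s: "odd s" "s \<in> {1..2 * m}" and even: "x (s + 1) = y (s + 1)"
      and A: "\<And>i'. i' \<in> ?A \<Longrightarrow> enc x (i', s + 1) = enc y (i', s + 1)"
      and B: "\<And>i'. i' \<in> ?B \<Longrightarrow> enc x (i', s) = enc y (i', s)"
    \<comment> \<open>The term with \<open>P r\<close> in the first symbol of node
      \<open>k + r\<close> involves only the decoded even half.\<close>
    have "dot k (v_vec r P S) (x s) = dot k (v_vec r P S) (y s)"
      using B[of "k + r"] enc_other_parity[OF r_ge] sbs_odd_last[OF s(1)] even by simp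
    moreover have "dot k (q_vec r P S j) (x s) = dot k (q_vec r P S j) (y s)"
      if "j \<in> {2..r - 1}" for j
    proof -
      have j: "2 \<le> j" "j \<le> r" "k + j \<in> ?A" using that by auto
      then show ?thesis
        using A[OF j(3)] enc_other_parity[OF j(1)] sbs_even[OF j(1,2), of "s + 1"] s even by simp
    qed
    ultimately have "dot k (q_vec r P S (r + 1)) (x s) = dot k (q_vec r P S (r + 1)) (y s)"
      unfolding dot_v_vec_blocks by simp
    then have "(\<Sum>j\<in>S r. P r j * x s j) = (\<Sum>j\<in>S r. P r j * y s j)"
      using r by (simp add: dot_q_vec)
    then show "x s i = y s i"
    proof (rule block_sum_determines[OF block_subset[OF r] i])
      show "x s j = y s j" if "j \<in> S r - {i}" for j
      proof -
        have "j \<le> k" using that block_subset[OF r] by auto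
        then show ?thesis using B[of j] that by (simp add: enc_systematic)
      qed
    qed
  qed (use r_ge ik block_subset[OF r] in auto)
  have "card ?A = (r - 1) + (k - 1)"
    using ik by (subst card_Un_disjoint) auto
  moreover have "card ?B = card (S r)"
  proof -
    have "k + r \<notin> S r" using block_subset[OF r] r_ge by auto
    then show ?thesis
      using finite_block[OF r] i card_Suc_Diff1[of "S r" i] by simp
  qed
  ultimately have "card ?A + card ?B = k + card (S r) + r - 2"
    using r_ge k_pos by simp
  with repairable show ?thesis by (simp only:)
qed

subsection \<open>Repair of the parity nodes\<close>

text \<open>Nothing is saved here: the systematic nodes are read in full.\<close>

lemma repair_parity_1:
  "repairable_with (k + r) (2 * m) (messages k m) enc (k + 1) (2 * m * k)"
proof (rule repairable_withI[where D = "{1..k} \<times> {1..2 * m}"])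
  fix x y s
  assume xy: "x \<in> messages k m" "y \<in> messages k m" and s: "s \<in> {1..2 * m}"
    and eq: "\<And>p. p \<in> {1..k} \<times> {1..2 * m} \<Longrightarrow> enc x p = enc y p"
  have "x s = y s" if "s \<in> {1..2 * m}" for s
    using that eq by (intro decode_substripe[OF xy, of "{1..k}"]) auto
  then have "x = y"
    using xy by (intro PiE_ext[of x "{1..2 * m}" _ y]) (auto simp: messages_def)
  then show "enc x (k + 1, s) = enc y (k + 1, s)" by simp
qed auto

lemma repair_parity:
  assumes j: "j \<in> {2..r}"
  shows "repairable_with (k + r) (2 * m) (messages k m) enc (k + j)
           ((m + 1) * k + (m - 1) * (r - 1))"
proof (rule repairable_withI)
  let ?A = "{k + 2..k + r} - {k + j}"
  \<comment> \<open>Node \<open>k + 1\<close> is read only where it carries a parity sum, and the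
    other \<open>r - 2\<close> parity nodes in the even substripes that feed these sums.\<close>
  let ?D = "({1..k} \<times> insert (2 * m) (odds m) \<union> ({k + 1} \<times> (odds m - {1})))
      \<union> ?A \<times> (evens m - {2 * m})"
  show "?D \<subseteq> ({1..k + r} - {k + j}) \<times> {1..2 * m}"
    using j m_pos by (auto simp: odds_def evens_def)
  have "card ?D = k * (m + 1) + (m - 1) + (r - 2) * (m - 1)"
  proof -
    have "2 * m \<notin> odds m" "1 \<in> odds m" "2 * m \<in> evens m"
      using m_pos by (auto simp: odds_def evens_def)
    then have "card (insert (2 * m) (odds m)) = m + 1" "card (odds m - {1}) = m - 1"
      "card (evens m - {2 * m}) = m - 1"
      by simp_all
    moreover have "card ?A = r - 2" using j by simp
    ultimately show ?thesis
      by (subst card_Un_disjoint, simp, simp, force,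
          subst card_Un_disjoint) (auto simp: card_cartesian_product)
  qed
  also have "\<dots> = (m + 1) * k + (m - 1) * (r - 1)"
  proof -
    \<comment> \<open>These substitutions eliminate the truncated subtractions.\<close>
    obtain r' where "r = r' + 2" using r_ge le_Suc_ex by (metis add.commute)
    moreover obtain m' where "m = m' + 1" using m_pos le_Suc_ex by (metis add.commute)
    ultimately show ?thesis by (simp add: algebra_simps)
  qed
  finally show "card ?D = (m + 1) * k + (m - 1) * (r - 1)" .
  fix x y s
  assume xy: "x \<in> messages k m" "y \<in> messages k m" and s: "s \<in> {1..2 * m}"
    and eq: "\<And>p. p \<in> ?D \<Longrightarrow> enc x p = enc y p"
  have known: "x e = y e" if "e \<in> insert (2 * m) (odds m)" for e
  proof (rule message_component_eqI[OF xy])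
    show "e \<in> {1..2 * m}" using that m_pos by (auto simp: odds_def)
    show "x e i = y e i" if "i \<in> {1..k}" for i
      using eq[of "(i, e)"] that \<open>e \<in> insert (2 * m) (odds m)\<close> by (simp add: enc_systematic)
  qed
  have even: "sbs x (k + j, e) = sbs y (k + j, e)" if "e \<in> evens m" for e
  proof (cases "e = 2 * m")
    case True
    \<comment> \<open>No later substripe carries the parity sum of substripe \<open>2 * m\<close>,
      so this symbol is computed from the messages of the last instance, both of which are
      read.\<close>
    have "2 * m - 1 \<in> odds m" using m_pos by (auto simp: odds_def)
    then show ?thesis
      using True j known[of "2 * m"] known[of "2 * m - 1"] by (simp add: sbs_even)
  next
    case False
    have e: "even e" "1 \<le> e" "e < 2 * m" "e \<in> evens m - {2 * m}"
      using that False by (auto simp: evens_def)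
    then have odd: "e + 1 \<in> odds m - {1}"
      by (auto simp: odds_def elim!: evenE)
    then have "enc x (k + 1, e + 1) = enc y (k + 1, e + 1)" "x (e + 1) = y (e + 1)"
      using known by (auto intro!: eq)
    \<comment> \<open>The odd message of substripe \<open>e + 1\<close> is known, so the base symbol
      can be subtracted from node \<open>k + 1\<close>.\<close>
    then have "(\<Sum>j=2..r. sbs x (k + j, e)) = (\<Sum>j=2..r. sbs y (k + j, e))"
      unfolding enc_parity_1_piggybacked[OF e(1-3)] by simp
    moreover have "(\<Sum>j\<in>{2..r} - {j}. sbs x (k + j, e)) = (\<Sum>j\<in>{2..r} - {j}. sbs y (k + j, e))"
    proof (rule sum.cong)
      fix j' assume j': "j' \<in> {2..r} - {j}"
      then have "enc x (k + j', e) = enc y (k + j', e)"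
        using e(4) by (intro eq) auto
      then show "sbs x (k + j', e) = sbs y (k + j', e)"
        using j' by (simp add: enc_other_parity)
    qed simp
    ultimately show ?thesis
      using j by (simp add: sum.remove[of "{2..r}" j])
  qed
  have "sbs x (k + j, s) = sbs y (k + j, s)"
  proof (cases "even s")
    case True
    then show ?thesis using even s by (simp add: evens_def)
  next
    case False
    \<comment> \<open>For \<open>j < r\<close> the odd symbol depends on a known message alone; for
      \<open>j = r\<close> the even symbol just recovered is also needed.\<close>
    then have "s \<in> odds m" "s + 1 \<in> evens m"
      using s Suc_odd_le[of s m] by (simp_all add: evens_def odds_def)
    then show ?thesis
      using j False known[of s] even[of "s + 1"]
      by (cases "j = r") (simp_all add: sbs_odd_last_cancel sbs_odd)
  qed
  then show "enc x (k + j, s) = enc y (k + j, s)"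
    using j by (simp add: enc_other_parity)
qed

end

section \<open>Averaging the repair costs over the systematic and the parity nodes\<close>

theorem mainTheorem5:
  fixes k r m n :: nat
    and P :: "nat \<Rightarrow> nat \<Rightarrow> 'a :: {field, finite}"
    and t t\<^sub>r :: int
    and S :: "nat \<Rightarrow> nat set"
  assumes "k \<ge> 1" and "r \<ge> 2" and "m \<ge> 1" and "n = k + r"
    and "MDS_code n k 1 (base_messages k) (base_code k P)"
    and "t = \<lceil>real k / real r + (real r - 2) / (2 * real r)\<rceil>"
    and "t\<^sub>r = int k - (int r - 1) * t"
    and "consecutive_blocks k r t t\<^sub>r S"
  shows "MDS_code n k (2 * m) (messages k m) (piggyback2 k r m P S)
    \<and> (\<forall>x\<in>messages k m. \<forall>i\<in>{1..k}. \<forall>s\<in>{1..2 * m}. piggyback2 k r m P S x (i, s) = x s i)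
    \<and> average_repair n (2 * m) (messages k m) (piggyback2 k r m P S) (2 * m * k) {1..k}
        (1 / (2 * real k ^ 2) *
          ((real k - of_int t\<^sub>r) * (real k + of_int t)
            + of_int t\<^sub>r * (real k + of_int t\<^sub>r + real r - 2)))
    \<and> average_repair n (2 * m) (messages k m) (piggyback2 k r m P S) (2 * m * k) {k + 1..k + r}
        (1 / (2 * real k * real r) *
          (2 * real k + (real r - 1) *
            ((1 + 1 / real m) * real k + (1 - 1 / real m) * (real r - 1))))"
proof -
  have t: "card (S l) = nat t" if "l \<in> {1..r - 1}" for l
    using assms(8) that unfolding consecutive_blocks_def by (metis nat_int)
  have tr: "int (card (S r)) = t\<^sub>r"
    using assms(8) unfolding consecutive_blocks_def by blast
  \<comment> \<open>Positivity under the ceiling gives \<open>t \<ge> 0\<close>, so that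
    \<open>nat t\<close> may be read as \<open>t\<close> in the average.\<close>
  have "real k / real r + (real r - 2) / (2 * real r) > 0"
    using assms(1,2) by (intro add_pos_nonneg) auto
  then have "t \<ge> 0" unfolding assms(6) by linarith
  interpret piggybacking k r m P S
  proof
    \<comment> \<open>By the ordering of the blocks a common element would be smaller than
      itself.\<close>
    show "S l \<inter> S l' = {}" if "l \<in> {1..r}" "l' \<in> {1..r}" "l \<noteq> l'" for l l'
      using assms(8) that unfolding consecutive_blocks_def
      by (metis disjoint_iff less_irrefl linorder_neq_iff)
  qed (use assms in \<open>auto simp: consecutive_blocks_def\<close>)
  have Sr: "S r \<subseteq> {1..k}" "finite (S r)"
    using block_subset[of r] finite_block[of r] assms(2) by auto

  have "average_repair n (2 * m) (messages k m) enc (2 * m * k) {1..k}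
        (1 / (2 * real k ^ 2) *
          ((real k - of_int t\<^sub>r) * (real k + of_int t)
            + of_int t\<^sub>r * (real k + of_int t\<^sub>r + real r - 2)))"
  proof (rule average_repairI)
    \<comment> \<open>All blocks but the last have size \<open>t\<close>, so the cost depends only
      on membership in \<open>S r\<close>.\<close>
    let ?\<rho> = "\<lambda>i. if i \<in> S r then m * (k + card (S r) + r - 2) else m * (k + nat t)"
    show "repairable_with n (2 * m) (messages k m) enc i (?\<rho> i)" if "i \<in> {1..k}" for i
    proof (cases "i \<in> S r")
      case True
      then show ?thesis using repair_systematic_last_block assms(4) by simp
    next
      case False
      have "i \<in> (\<Union>l\<in>{1..r}. S l)" using that blocks_union by simp
      then obtain l where l: "l \<in> {1..r}" "i \<in> S l" by blast
      then have "l \<in> {1..r - 1}" using False by (cases "l = r") auto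
      then show ?thesis using repair_systematic[of l i] l False t assms(4) by simp
    qed
    have "(\<Sum>i\<in>{1..k}. real (?\<rho> i)) =
        (\<Sum>i\<in>{1..k} - S r. real (?\<rho> i)) + (\<Sum>i\<in>S r. real (?\<rho> i))"
      using Sr by (intro sum.subset_diff) auto
    also have "\<dots> = real (card ({1..k} - S r)) * real (m * (k + nat t))
        + real (card (S r)) * real (m * (k + card (S r) + r - 2))"
      by simp
    also have "real (card ({1..k} - S r)) = real k - of_int t\<^sub>r"
      using Sr card_mono[OF _ Sr(1)] by (simp add: card_Diff_subset of_nat_diff flip: tr)
    also have "real (card (S r)) * real (m * (k + card (S r) + r - 2)) =
        of_int t\<^sub>r * (real m * (real k + of_int t\<^sub>r + real r - 2))"
      using assms(2) by (simp add: of_nat_diff flip: tr)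
    also have "real (m * (k + nat t)) = real m * (real k + of_int t)"
      using \<open>t \<ge> 0\<close> by simp
    finally show "(\<Sum>i\<in>{1..k}. real (?\<rho> i)) / (real (2 * m * k) * real (card {1..k})) =
        1 / (2 * real k ^ 2) * ((real k - of_int t\<^sub>r) * (real k + of_int t)
            + of_int t\<^sub>r * (real k + of_int t\<^sub>r + real r - 2))"
      using assms(1,3) by (simp add: field_simps power2_eq_square)
  qed
  moreover have "average_repair n (2 * m) (messages k m) enc (2 * m * k) {k + 1..k + r}
        (1 / (2 * real k * real r) *
          (2 * real k + (real r - 1) *
            ((1 + 1 / real m) * real k + (1 - 1 / real m) * (real r - 1))))"
  proof (rule average_repairI)
    let ?c = "(m + 1) * k + (m - 1) * (r - 1)"
    let ?\<rho> = "\<lambda>i. if i = k + 1 then 2 * m * k else ?c"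
    show "repairable_with n (2 * m) (messages k m) enc i (?\<rho> i)" if "i \<in> {k + 1..k + r}" for i
      using node_cases[of i] that assms(4) repair_parity_1 repair_parity by auto
    have "{k + 1..k + r} = insert (k + 1) {k + 2..k + r}" using assms(2) by auto
    then have "(\<Sum>i\<in>{k + 1..k + r}. real (?\<rho> i)) =
        real (2 * m * k) + (\<Sum>i\<in>{k + 2..k + r}. real (?\<rho> i))"
      by simp
    also have "(\<Sum>i\<in>{k + 2..k + r}. real (?\<rho> i)) = (\<Sum>i\<in>{k + 2..k + r}. real ?c)"
      by (rule sum.cong) auto
    also have "\<dots> = (real r - 1) * ((real m + 1) * real k + (real m - 1) * (real r - 1))"
      using assms(2,3) by (simp add: of_nat_diff distrib_right)
    finally have total: "(\<Sum>i\<in>{k + 1..k + r}. real (?\<rho> i)) =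
        real (2 * m * k) + (real r - 1) * ((real m + 1) * real k + (real m - 1) * (real r - 1))" .
    \<comment> \<open>Dividing by \<open>m\<close> turns \<open>m + 1\<close> and
      \<open>m - 1\<close> into \<open>1 + 1 / m\<close> and \<open>1 - 1 / m\<close>.\<close>
    show "(\<Sum>i\<in>{k + 1..k + r}. real (?\<rho> i)) / (real (2 * m * k) * real (card {k + 1..k + r})) =
        1 / (2 * real k * real r) *
          (2 * real k + (real r - 1) *
            ((1 + 1 / real m) * real k + (1 - 1 / real m) * (real r - 1)))"
      unfolding total using assms(1-3) by (simp add: field_simps)
  qed
  ultimately show ?thesis
    using piggyback2_MDS assms(4) by (simp add: enc_systematic)
qed

end
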